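(* Let $t$, $v$, $k$, $\lambda$ and $s$ be positive integers such that $t < k < v$ and $s \leq \lfloor\frac{t}{2}\rfloor$. Let $b_{2s},b_{2s-1},\ldots,b_s$ be positive integers such that (i) $L_\lambda(v-2s,k-2s,t-2s) \leq b_{2s} \leq C_\lambda(v-2s,k-2s,t-2s)$; (ii) $\left\lceil \frac{v-i}{k-i}\, b_{i+1} \right\rceil \leq b_i \leq C_\lambda(v-i,k-i,t-i)$ for $i = 2s-1,2s-2,\ldots,s$; and (iii) $a_j \geq 0$ for $j \in \{0,\ldots,s\}$, where $a_j=\sum_{i=0}^j (-1)^{i+j}\binom{j}{i}b_{2s-i}$. Let $d=b_s\left(\binom{k}{s}-1\right)-\sum_{i=0}^{s-1}\binom{s}{i}\binom{v-s}{s-i}b_{2s-i}$. Suppose that $b_s < \binom{k}{s}$ and that $d \geq a_s \geq 1$. Then \[C_{\lambda}(v,k,t) \geq \left\lceil CB_{(v,k,\lambda;s)}\left(\frac{a_s+1}{2(d+1)},\ \frac{a_s+1}{2\left(d+\binom{k}{s}\right)}\right)\right\rceil,\] where, for real numbers $\alpha,\beta$, \[CB_{(v,k,\lambda;s)}(\alpha,\beta) = \frac{b_s(\alpha-\beta)\binom{v}{s}+\alpha \binom{v}{s}}{(\alpha-\beta)\binom{k}{s}+1}.\]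
   Context: An incidence structure is a pair $(V,\mathcal{B})$ where $V$ is a (finite) set of points and $\mathcal{B}$ is a multiset of subsets of $V$ called blocks (numbers of blocks are counted with multiplicity). For positive integers $t,v,k,\lambda$ with $t \leq k \leq v$, a $t$-$(v,k,\lambda)$ covering is an incidence structure $(V,\mathcal{B})$ such that $|V|=v$, $|B|=k$ for all $B\in\mathcal{B}$, and each $t$-subset of $V$ is contained in at least $\lambda$ blocks in $\mathcal{B}$. The covering number $C_\lambda(v,k,t)$ is the minimum number of blocks in any $t$-$(v,k,\lambda)$ covering; by convention $C_\lambda(v,k,0)=\lambda$ for all $v,k,\lambda$. For $t\ge 1$, \[L_{\lambda}(v,k,t) = \left\lceil\frac{v}{k} \left\lceil\frac{v-1}{k-1} \cdots \left\lceil\frac{v-t+2}{k-t+2} \left\lceil\frac{\lambda(v-t+1)}{k-t+1} \right\rceil \right\rceil \cdots \right\rceil \right\rceil\] (the Schönheim bound), and $L_\lambda(v,k,0)=\lambda$. *)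

theory Defs
  imports Complex_Main "HOL-Library.Multiset"
begin

definition incidence_structure :: "'a set \<Rightarrow> 'a set multiset \<Rightarrow> bool" where
  "incidence_structure V \<B> \<longleftrightarrow> finite V \<and> (\<forall>B \<in># \<B>. B \<subseteq> V)"

text \<open>Argument order: \<open>covering t v k lam V \<B>\<close> says that \<open>(V, \<B>)\<close> is a
  \<open>t\<close>-\<open>(v, k, lam)\<close> covering; blocks are counted with multiplicity.\<close>

definition covering ::
    "nat \<Rightarrow> nat \<Rightarrow> nat \<Rightarrow> nat \<Rightarrow> 'a set \<Rightarrow> 'a set multiset \<Rightarrow> bool" where
  "covering t v k lam V \<B> \<longleftrightarrow>
     incidence_structure V \<B> \<and> card V = v \<and> (\<forall>B \<in># \<B>. card B = k) \<and>
     (\<forall>T. T \<subseteq> V \<and> card T = t \<longrightarrow> lam \<le> size {#B \<in># \<B>. T \<subseteq> B#})"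

text \<open>Taking natural numbers as points is no restriction: see \<open>covering_number_le\<close>, where the
  points have arbitrary type. The least element exists for \<open>t \<le> k \<le> v\<close>: see
  \<open>covering_number_attained\<close>.\<close>

definition covering_number :: "nat \<Rightarrow> nat \<Rightarrow> nat \<Rightarrow> nat \<Rightarrow> nat" where
  "covering_number lam v k t =
     (if t = 0 then lam
      else LEAST n. \<exists>(V :: nat set) \<B>. covering t v k lam V \<B> \<and> size \<B> = n)"

lemma covering_number_le:
  fixes V :: "'a set"
  assumes cov: "covering t v k lam V \<B>" and t: "0 < t"
  shows "covering_number lam v k t \<le> size \<B>"
proof -
  have fin: "finite V" and sub: "\<And>B. B \<in># \<B> \<Longrightarrow> B \<subseteq> V" and cV: "card V = v"
    and ck: "\<And>B. B \<in># \<B> \<Longrightarrow> card B = k"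
    and ct: "\<And>T. T \<subseteq> V \<Longrightarrow> card T = t \<Longrightarrow> lam \<le> size {#B \<in># \<B>. T \<subseteq> B#}"
    using cov by (auto simp: covering_def incidence_structure_def)
  obtain f :: "'a \<Rightarrow> nat" where inj: "inj_on f V"
    using finite_imp_inj_to_nat_seg[OF fin] by blast
  define \<C> where "\<C> = image_mset (image f) \<B>"
  have "covering t v k lam (f ` V) \<C>"
    unfolding covering_def incidence_structure_def
  proof (intro conjI ballI allI impI)
    show "finite (f ` V)" using fin by simp
    show "card (f ` V) = v" using inj cV by (simp add: card_image)
    show "C \<subseteq> f ` V" if "C \<in># \<C>" for C
      using that sub by (fastforce simp: \<C>_def)
    show "card C = k" if C: "C \<in># \<C>" for C
    proof -
      obtain B where B: "B \<in># \<B>" "C = f ` B" using C by (auto simp: \<C>_def)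
      then have "inj_on f B" using inj sub by (meson inj_on_subset)
      then show ?thesis using B ck by (simp add: card_image)
    qed
    show "lam \<le> size {#C \<in># \<C>. T \<subseteq> C#}" if T: "T \<subseteq> f ` V \<and> card T = t" for T
    proof -
      obtain S where S: "S \<subseteq> V" "T = f ` S" using T by (meson subset_imageE)
      have "inj_on f S" using inj S(1) by (rule inj_on_subset)
      then have "card S = t" using T S by (simp add: card_image)
      then have "lam \<le> size {#B \<in># \<B>. S \<subseteq> B#}" using ct S by simp
      also have "{#B \<in># \<B>. S \<subseteq> B#} = {#B \<in># \<B>. T \<subseteq> f ` B#}"
      proof (rule filter_mset_cong[OF refl])
        fix B assume "B \<in># \<B>"
        then have "f x \<in> f ` B \<longleftrightarrow> x \<in> B" if "x \<in> S" for x
          using that inj S(1) sub inj_on_image_mem_iff by (metis subsetD)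
        then show "S \<subseteq> B \<longleftrightarrow> T \<subseteq> f ` B" using S(2) by blast
      qed
      also have "size \<dots> = size {#C \<in># \<C>. T \<subseteq> C#}"
        by (simp add: \<C>_def filter_mset_image_mset)
      finally show ?thesis .
    qed
  qed
  moreover have "size \<C> = size \<B>" by (simp add: \<C>_def)
  ultimately show ?thesis
    using t unfolding covering_number_def by (auto intro!: Least_le)
qed

lemma covering_number_attained:
  assumes "0 < t" "t \<le> k" "k \<le> v"
  shows "\<exists>(V :: nat set) \<B>. covering t v k lam V \<B> \<and> size \<B> = covering_number lam v k t"
proof -
  define P where "P n \<longleftrightarrow> (\<exists>(V :: nat set) \<B>. covering t v k lam V \<B> \<and> size \<B> = n)" for n
  define \<K> where "\<K> = {B. B \<subseteq> {..<v} \<and> card B = k}"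
  define \<B> where "\<B> = repeat_mset lam (mset_set \<K>)"
  have fin: "finite \<K>" by (simp add: \<K>_def)
  have mem: "B \<in> \<K>" if "B \<in># \<B>" for B
    using that fin by (auto simp: \<B>_def count_greater_zero_iff[symmetric] count_mset_set'
      simp del: count_greater_zero_iff split: if_splits)
  have "lam \<le> size {#B \<in># \<B>. T \<subseteq> B#}" if T: "T \<subseteq> {..<v}" "card T = t" for T
  proof -
    have "\<exists>B. T \<subseteq> B \<and> B \<subseteq> {..<v} \<and> card B = k"
      using exists_subset_between[of T k "{..<v}"] T assms by auto
    then obtain B where B: "T \<subseteq> B" "B \<in> \<K>" by (auto simp: \<K>_def)
    have "lam = count {#B \<in># \<B>. T \<subseteq> B#} B" using B fin by (simp add: \<B>_def)
    also have "\<dots> \<le> size {#B \<in># \<B>. T \<subseteq> B#}" by (rule count_le_size)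
    finally show ?thesis .
  qed
  then have "covering t v k lam {..<v} \<B>"
    using mem by (auto simp: covering_def incidence_structure_def \<K>_def)
  then have "P (size \<B>)" by (auto simp: P_def)
  then have "P (Least P)" by (rule LeastI)
  moreover have "covering_number lam v k t = Least P"
    using assms by (simp add: covering_number_def P_def[abs_def])
  ultimately show ?thesis by (simp add: P_def)
qed

text \<open>Starting the recursion with \<open>lam\<close> at \<open>t = 0\<close> yields
  \<open>\<lceil>lam(v - t + 1) / (k - t + 1)\<rceil>\<close> as the innermost factor.\<close>

fun schonheim_bound :: "nat \<Rightarrow> nat \<Rightarrow> nat \<Rightarrow> nat \<Rightarrow> int" where
  "schonheim_bound lam v k 0 = int lam"
| "schonheim_bound lam v k (Suc t) =
     \<lceil>real v / real k * real_of_int (schonheim_bound lam (v - 1) (k - 1) t)\<rceil>"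

text \<open>The argument \<open>bs\<close> stands for the fixed number \<open>b\<^sub>s\<close>; the value depends on \<open>lam\<close> only
  through it.\<close>

definition CB :: "nat \<Rightarrow> nat \<Rightarrow> nat \<Rightarrow> int \<Rightarrow> real \<Rightarrow> real \<Rightarrow> real" where
  "CB v k s bs \<alpha> \<beta> =
     (real_of_int bs * (\<alpha> - \<beta>) * real (v choose s) + \<alpha> * real (v choose s)) /
     ((\<alpha> - \<beta>) * real (k choose s) + 1)"

end

theory Submission
  imports Defs
begin

text \<open>
  Let \<open>M\<close> be the incidence matrix with a row for each \<open>s\<close>-subset of the point set and a column
  for each block. The number of blocks is at least the rank of \<open>M\<close>, hence at least the size of any
  set of linearly independent rows, as in the usual proof of Fisher's inequality. The proof finds
  many independent rows.

  The entry of \<open>M M\<^sup>T\<close> at \<open>(S, T)\<close> is the number of blocks containing \<open>S \<union> T\<close>. Since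
  \<open>s \<le> |S \<union> T| = 2s - |S \<inter> T| \<le> 2s \<le> t\<close>, the blocks through \<open>S \<union> T\<close> form a derived covering
  (\<open>covering_number_le_replication\<close>), so the entry is at least \<open>b\<^bsub>2s - |S \<inter> T|\<^esub>\<close>. Thus
  \<open>M M\<^sup>T = P + E\<close> with \<open>P\<close> given by these lower bounds and \<open>E\<close> entrywise nonnegative. Binomial
  inversion of the definition of the \<open>a\<^sub>j\<close> turns \<open>P\<close> into \<open>\<Sum>\<^sub>j a\<^sub>j W\<^sub>j\<^sup>T W\<^sub>j\<close>, where \<open>W\<^sub>j\<close> is the
  inclusion matrix of \<open>j\<close>-subsets in \<open>s\<close>-subsets. Every summand is positive semidefinite, and the last
  one is \<open>a\<^sub>s I\<close>. Consequently any set of rows on which the off-diagonal row sums of \<open>E\<close> stay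
  below \<open>a\<^sub>s\<close> is independent (\<open>card_le_size_if_small_excess\<close>).

  Read \<open>E\<close> as a multigraph on the \<open>s\<close>-subsets. Double counting shows that the degree of \<open>S\<close> is
  \<open>d + e\<^sub>S (K - 1)\<close>, where \<open>K = k choose s\<close> and \<open>e\<^sub>S\<close> is the number of blocks through \<open>S\<close>
  in excess of \<open>b\<^sub>s\<close>. A theorem of Caro and Tuza on induced subgraphs of bounded degree
  (\<open>caro_tuza_bound\<close>) yields a suitable set of rows of size at least
  \<open>\<Sum>\<^sub>S (a\<^sub>s + 1) / (2 (deg S + 1))\<close>. By convexity each summand is at least
  \<open>\<alpha> - (\<alpha> - \<beta>) e\<^sub>S\<close>, the secant through \<open>e\<^sub>S = 0\<close> and \<open>e\<^sub>S = 1\<close>: these two values are the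
  arguments \<open>\<alpha>\<close> and \<open>\<beta>\<close> of \<open>CB\<close>. Finally \<open>\<Sum>\<^sub>S e\<^sub>S\<close> is the number of blocks times \<open>K\<close> minus
  \<open>b\<^sub>s (v choose s)\<close>, so the inequality becomes linear in the number of blocks, and solving it gives
  \<open>CB\<close>.
\<close>

section \<open>Homogeneous linear systems\<close>

text \<open>This replaces the rank argument: if there were more selected rows of the incidence matrix than
  blocks, some nontrivial combination of them would vanish. The proof is Gaussian elimination of one
  unknown and one equation at a time.\<close>

lemma exists_nontrivial_solution:
  fixes c :: "'e \<Rightarrow> 'a \<Rightarrow> 'f::field"
  assumes "finite E" "finite X" "card E < card X"
  shows "\<exists>x. (\<exists>p\<in>X. x p \<noteq> 0) \<and> (\<forall>e\<in>E. (\<Sum>p\<in>X. c e p * x p) = 0)"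
  using assms
proof (induction E arbitrary: X c rule: finite_induct)
  case empty
  then have "X \<noteq> {}" by auto
  then show ?case by (intro exI[of _ "\<lambda>_. 1"]) auto
next
  case (insert e E)
  show ?case
  proof (cases "\<forall>p\<in>X. c e p = 0")
    case True
    have "card E < card X" using insert by simp
    from insert.IH[OF insert.prems(1) this, of c] True show ?thesis by auto
  next
    case False
    then obtain p where p: "p \<in> X" "c e p \<noteq> 0" by blast
    define c' where "c' i q = c i q - c i p / c e p * c e q" for i q
    have "card E < card (X - {p})" using insert p by simp
    with insert.IH[of "X - {p}" c'] insert.prems(1) obtain y where
      y: "\<exists>q\<in>X - {p}. y q \<noteq> 0" "\<forall>i\<in>E. (\<Sum>q\<in>X - {p}. c' i q * y q) = 0" by auto
    \<comment> \<open>Back-substitution: the value at the pivot \<open>p\<close> is forced by the equation \<open>e\<close>.\<close>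
    define x where "x q = (if q = p then - (\<Sum>q\<in>X - {p}. c e q * y q) / c e p else y q)" for q
    have split: "(\<Sum>q\<in>X. c i q * x q) = c i p * x p + (\<Sum>q\<in>X - {p}. c i q * y q)" for i
    proof -
      have "(\<Sum>q\<in>X. c i q * x q) = c i p * x p + (\<Sum>q\<in>X - {p}. c i q * x q)"
        using insert.prems(1) p(1) by (rule sum.remove)
      also have "(\<Sum>q\<in>X - {p}. c i q * x q) = (\<Sum>q\<in>X - {p}. c i q * y q)"
        by (rule sum.cong) (auto simp: x_def)
      finally show ?thesis .
    qed
    have "(\<Sum>q\<in>X. c i q * x q) = (\<Sum>q\<in>X - {p}. c' i q * y q)" for i
      unfolding split c'_def
      by (simp add: x_def left_diff_distrib sum_subtractf sum_distrib_left sum_divide_distrib mult.assoc)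
    with y(2) have "\<forall>i\<in>E. (\<Sum>q\<in>X. c i q * x q) = 0" by simp
    moreover have "(\<Sum>q\<in>X. c e q * x q) = 0"
      unfolding split using p(2) by (simp add: x_def)
    moreover have "\<exists>q\<in>X. x q \<noteq> 0" using y(1) by (auto simp: x_def)
    ultimately show ?thesis by auto
  qed
qed

section \<open>Induced submultigraphs of small degree\<close>

text \<open>The weight is decreasing and convex in the degree, being linear up to degree \<open>m\<close>. The formulas
  for the two ranges agree at degree \<open>m - 1\<close>, with value \<open>(m + 1) / (2 m)\<close>, and also at degree
  \<open>m\<close>, with value \<open>1/2\<close>.\<close>

definition caro_tuza_weight :: "nat \<Rightarrow> nat \<Rightarrow> real" where
  "caro_tuza_weight m x =
     (if x < m then 1 - real x / (2 * real m) else (real m + 1) / (2 * (real x + 1)))"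

text \<open>For \<open>D \<ge> m\<close> the last step of the weight before \<open>D\<close> is exactly \<open>caro_tuza_weight m D / D\<close>. By
  convexity every earlier step is at least as large, so lowering a degree that is at most \<open>D\<close> by
  \<open>w\<close> gains at least \<open>w\<close> times this amount.\<close>

lemma caro_tuza_weight_drop:
  assumes m: "0 < m" "m \<le> D" and yD: "y + w \<le> D"
  shows "caro_tuza_weight m (y + w) + real w * (caro_tuza_weight m D / real D)
           \<le> caro_tuza_weight m y"
  using yD
proof (induction w)
  case 0
  then show ?case by simp
next
  case (Suc w)
  define z where "z = y + w"
  have z: "z + 1 \<le> D" using Suc by (simp add: z_def)
  have slope: "caro_tuza_weight m D / real D = (real m + 1) / (2 * real D * (real D + 1))"
    using m by (simp add: caro_tuza_weight_def)
  have step: "caro_tuza_weight m (z + 1) + caro_tuza_weight m D / real D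
      \<le> caro_tuza_weight m z"
  proof (cases "z < m")
    case True
    have "(real m + 1) / (2 * real D * (real D + 1)) \<le> (real m + 1) / (2 * real m * (real m + 1))"
      using m by (intro divide_left_mono mult_mono) auto
    also have "\<dots> = 1 / (2 * real m)" by (simp add: divide_simps)
    finally have "caro_tuza_weight m D / real D \<le> 1 / (2 * real m)" using slope by simp
    moreover have "caro_tuza_weight m (z + 1) = caro_tuza_weight m z - 1 / (2 * real m)"
    proof (cases "z + 1 < m")
      case True
      then show ?thesis using m by (simp add: caro_tuza_weight_def field_simps)
    next
      case False
      with True have "m = z + 1" by simp
      then show ?thesis
        by (simp add: caro_tuza_weight_def divide_simps) (simp add: algebra_simps)
    qed
    ultimately show ?thesis by simp
  next
    case False
    have "(real m + 1) / (2 * real D * (real D + 1))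
        \<le> (real m + 1) / (2 * (real z + 1) * (real z + 2))"
      using m z by (intro divide_left_mono mult_mono) auto
    also have "\<dots> = caro_tuza_weight m z - caro_tuza_weight m (z + 1)"
      using False by (simp add: caro_tuza_weight_def divide_simps) (simp add: algebra_simps)
    finally show ?thesis using slope by simp
  qed
  have "caro_tuza_weight m z + real w * (caro_tuza_weight m D / real D) \<le> caro_tuza_weight m y"
    using Suc by (simp add: z_def)
  with step show ?case
    by (simp add: z_def algebra_simps add_divide_distrib)
qed

text \<open>Delete a vertex of maximum degree \<open>D\<close> as long as \<open>D \<ge> m\<close>. The deleted vertex loses the weight of
  \<open>D\<close>, but the edges at it, \<open>D\<close> in number, each return a \<open>D\<close>-th part of that weight to a remaining
  vertex, so the total weight does not decrease. Once all degrees are below \<open>m\<close>, every vertex has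
  weight at most \<open>1\<close>. The function \<open>w\<close> gives the edge multiplicities.\<close>

lemma caro_tuza_bound:
  fixes w :: "'a \<Rightarrow> 'a \<Rightarrow> nat"
  assumes "finite V" and sym: "\<And>u v. w u v = w v u" and m: "0 < m"
  shows "\<exists>X\<subseteq>V. (\<forall>u\<in>X. (\<Sum>v\<in>X - {u}. w u v) < m) \<and>
           (\<Sum>u\<in>V. caro_tuza_weight m (\<Sum>v\<in>V - {u}. w u v)) \<le> real (card X)"
  using assms(1)
proof (induction V rule: finite_psubset_induct)
  case (psubset V)
  define deg where "deg U u = (\<Sum>v\<in>U - {u}. w u v)" for U u
  show ?case
  proof (cases "\<forall>u\<in>V. deg V u < m")
    case True
    have "(\<Sum>u\<in>V. caro_tuza_weight m (deg V u)) \<le> (\<Sum>u\<in>V. 1)"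
      using True m by (intro sum_mono) (auto simp: caro_tuza_weight_def)
    then show ?thesis using True by (intro exI[of _ V]) (auto simp: deg_def)
  next
    case False
    then have V: "V \<noteq> {}" by auto
    define D where "D = Max (deg V ` V)"
    have le: "deg V u \<le> D" if "u \<in> V" for u
      using that psubset.hyps by (simp add: D_def)
    have "D \<in> deg V ` V" using V psubset.hyps by (simp add: D_def)
    then obtain u where u: "u \<in> V" "deg V u = D" by auto
    have mD: "m \<le> D" using False le by force
    have deg: "deg V z = deg (V - {u}) z + w z u" if "z \<in> V - {u}" for z
    proof -
      have "V - {z} - {u} = V - {u} - {z}" by auto
      moreover have "u \<in> V - {z}" using that u(1) by auto
      ultimately show ?thesis
        using psubset.hyps sum.remove[of "V - {z}" u "w z"] by (simp add: deg_def)
    qed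
    have "(\<Sum>z\<in>V. caro_tuza_weight m (deg V z))
        = caro_tuza_weight m D + (\<Sum>z\<in>V - {u}. caro_tuza_weight m (deg V z))"
      using u psubset.hyps by (simp add: sum.remove)
    also have "caro_tuza_weight m D
        = (\<Sum>z\<in>V - {u}. real (w z u)) * (caro_tuza_weight m D / real D)"
    proof -
      have "(\<Sum>z\<in>V - {u}. w z u) = D" using u(2) by (simp add: deg_def sym)
      then have "(\<Sum>z\<in>V - {u}. real (w z u)) = real D" by (metis of_nat_sum)
      then show ?thesis using mD m by simp
    qed
    also have "(\<Sum>z\<in>V - {u}. real (w z u)) * (caro_tuza_weight m D / real D)
          + (\<Sum>z\<in>V - {u}. caro_tuza_weight m (deg V z))
        = (\<Sum>z\<in>V - {u}. caro_tuza_weight m (deg (V - {u}) z + w z u)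
             + real (w z u) * (caro_tuza_weight m D / real D))"
      by (simp add: sum.distrib sum_distrib_right sum_divide_distrib deg)
    also have "\<dots> \<le> (\<Sum>z\<in>V - {u}. caro_tuza_weight m (deg (V - {u}) z))"
    proof (rule sum_mono)
      fix z assume z: "z \<in> V - {u}"
      show "caro_tuza_weight m (deg (V - {u}) z + w z u)
              + real (w z u) * (caro_tuza_weight m D / real D)
            \<le> caro_tuza_weight m (deg (V - {u}) z)"
        using z deg[OF z] le[of z] by (intro caro_tuza_weight_drop m mD) simp
    qed
    finally have drop: "(\<Sum>z\<in>V. caro_tuza_weight m (deg V z))
        \<le> (\<Sum>z\<in>V - {u}. caro_tuza_weight m (deg (V - {u}) z))" .
    obtain X where X: "X \<subseteq> V - {u}" "\<forall>u\<in>X. deg X u < m"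
      "(\<Sum>z\<in>V - {u}. caro_tuza_weight m (deg (V - {u}) z)) \<le> real (card X)"
      using psubset.IH[of "V - {u}"] u(1) unfolding deg_def by blast
    then show ?thesis
      using drop by (intro exI[of _ X]) (auto simp: deg_def)
  qed
qed

section \<open>Binomial inversion and intersection numbers\<close>

lemma binomial_inversion:
  fixes g :: "nat \<Rightarrow> 'a::comm_ring_1"
  shows "(\<Sum>j\<le>n. of_nat (n choose j) * (\<Sum>i\<le>j. (-1) ^ (i + j) * of_nat (j choose i) * g i)) = g n"
proof -
  have coeff: "(\<Sum>j\<le>n. (-1) ^ (i + j) * of_nat (n choose j) * of_nat (j choose i))
      = (of_bool (i = n) :: 'a)" if "i \<le> n" for i
  proof -
    have "(\<Sum>j\<le>n. (-1) ^ (i + j) * of_nat (n choose j) * of_nat (j choose i) :: 'a)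
        = (\<Sum>j=i..n. (-1) ^ (i + j) * of_nat (n choose j) * of_nat (j choose i))"
      by (rule sum.mono_neutral_right) (auto simp: not_le binomial_eq_0)
    also have "\<dots> = (\<Sum>l\<le>n - i. (-1) ^ l * of_nat (n choose i) * of_nat ((n - i) choose l))"
    proof (rule sum.reindex_bij_witness[of _ "\<lambda>l. i + l" "\<lambda>j. j - i"])
      fix j assume j: "j \<in> {i..n}"
      have "(n choose j) * (j choose i) = (n choose i) * ((n - i) choose (j - i))"
        using j by (simp add: choose_mult)
      then have "of_nat (n choose j) * of_nat (j choose i)
          = (of_nat (n choose i) * of_nat ((n - i) choose (j - i)) :: 'a)"
        by (metis of_nat_mult)
      moreover have "(-1) ^ (i + j) = ((-1) ^ (j - i) :: 'a)"
        using j by (auto simp: uminus_power_if)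
      ultimately show "(-1) ^ (j - i) * of_nat (n choose i) * of_nat ((n - i) choose (j - i))
          = ((-1) ^ (i + j) * of_nat (n choose j) * of_nat (j choose i) :: 'a)"
        by (simp add: mult.assoc)
    qed (use that in auto)
    also have "\<dots> = of_nat (n choose i) * (\<Sum>l\<le>n - i. (-1) ^ l * of_nat ((n - i) choose l))"
      by (simp add: sum_distrib_left mult_ac)
    also have "\<dots> = of_bool (i = n)"
      using that choose_alternating_sum[of "n - i", where 'a = 'a] by (cases "i = n") auto
    finally show ?thesis .
  qed
  have "(\<Sum>j\<le>n. of_nat (n choose j) * (\<Sum>i\<le>j. (-1) ^ (i + j) * of_nat (j choose i) * g i))
      = (\<Sum>j\<le>n. of_nat (n choose j) * (\<Sum>i\<le>n. (-1) ^ (i + j) * of_nat (j choose i) * g i))"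
    by (rule sum.cong[OF refl], rule arg_cong2[of _ _ _ _ "(*)", OF refl],
        rule sum.mono_neutral_left) (auto simp: not_le binomial_eq_0)
  also have "\<dots> = (\<Sum>i\<le>n. (\<Sum>j\<le>n. (-1) ^ (i + j) * of_nat (n choose j) * of_nat (j choose i)) * g i)"
    unfolding sum_distrib_left sum_distrib_right
    by (subst sum.swap) (simp add: mult_ac)
  also have "\<dots> = (\<Sum>i\<le>n. of_bool (i = n) * g i)"
    by (rule sum.cong[OF refl], subst coeff) simp_all
  also have "\<dots> = g n" by (simp add: of_bool_def if_distrib[of "\<lambda>x. x * _"] cong: if_cong)
  finally show ?thesis .
qed

lemma card_Int_less:
  assumes "finite S" "finite T" "card S = card T" "S \<noteq> T"
  shows "card (S \<inter> T) < card S"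
proof -
  have "S \<inter> T \<subset> S"
    using assms by (metis Int_lower1 card_subset_eq inf.absorb_iff1 psubsetI)
  then show ?thesis using assms(1) by (rule psubset_card_mono[rotated])
qed

text \<open>Such a \<open>T\<close> is determined by its part inside \<open>S\<close> and its part outside \<open>S\<close>, which can be
  chosen independently.\<close>

lemma card_subsets_meeting:
  assumes V: "finite V" and S: "S \<subseteq> V" and i: "i \<le> q"
  shows "card {T. T \<subseteq> V \<and> card T = q \<and> card (S \<inter> T) = i}
           = (card S choose i) * ((card V - card S) choose (q - i))"
proof -
  have fin: "finite S" "finite (V - S)" using V S by (auto intro: finite_subset)
  let ?A = "{A. A \<subseteq> S \<and> card A = i}" and ?B = "{B. B \<subseteq> V - S \<and> card B = q - i}"
  have "bij_betw (\<lambda>T. (S \<inter> T, T - S)) {T. T \<subseteq> V \<and> card T = q \<and> card (S \<inter> T) = i} (?A \<times> ?B)"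
  proof (rule bij_betw_byWitness[where f' = "\<lambda>(A, B). A \<union> B"])
    show "(\<lambda>T. (S \<inter> T, T - S)) ` {T. T \<subseteq> V \<and> card T = q \<and> card (S \<inter> T) = i} \<subseteq> ?A \<times> ?B"
      using V by (auto simp: card_Diff_subset_Int Int_commute finite_subset)
    show "(\<lambda>(A, B). A \<union> B) ` (?A \<times> ?B) \<subseteq> {T. T \<subseteq> V \<and> card T = q \<and> card (S \<inter> T) = i}"
    proof clarsimp
      fix A B assume AB: "A \<subseteq> S" "i = card A" "B \<subseteq> V - S" "card B = q - card A"
      have "A \<inter> B = {}" "S \<inter> (A \<union> B) = A" using AB by auto
      moreover have "finite A" "finite B" using AB fin finite_subset by blast+
      ultimately show "A \<subseteq> V \<and> B \<subseteq> V \<and> card (A \<union> B) = q \<and> card (S \<inter> (A \<union> B)) = card A"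
        using AB S i by (auto simp: card_Un_disjoint)
    qed
  qed auto
  then have "card {T. T \<subseteq> V \<and> card T = q \<and> card (S \<inter> T) = i} = card (?A \<times> ?B)"
    by (rule bij_betw_same_card)
  also have "\<dots> = (card S choose i) * ((card V - card S) choose (q - i))"
    using fin S by (simp add: card_cartesian_product n_subsets card_Diff_subset)
  finally show ?thesis .
qed

lemma sum_by_intersection_size:
  fixes g :: "nat \<Rightarrow> 'b::comm_semiring_1"
  assumes V: "finite V" and S: "S \<subseteq> V" "card S = s"
  shows "(\<Sum>T\<in>{T. T \<subseteq> V \<and> card T = s} - {S}. g (card (S \<inter> T)))
           = (\<Sum>i<s. of_nat (s choose i) * of_nat ((card V - s) choose (s - i)) * g i)"
proof -
  let ?F = "{T. T \<subseteq> V \<and> card T = s}"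
  have fin: "finite T" if "T \<subseteq> V" for T using that V by (rule finite_subset)
  have less: "card (S \<inter> T) < s" if "T \<in> ?F - {S}" for T
    using that S fin card_Int_less[of S T] by auto
  have "(\<Sum>T\<in>?F - {S}. g (card (S \<inter> T)))
      = (\<Sum>i<s. \<Sum>T\<in>{T \<in> ?F - {S}. card (S \<inter> T) = i}. g (card (S \<inter> T)))"
    using V less by (intro sum.group[symmetric]) auto
  also have "\<dots> = (\<Sum>i<s. of_nat (s choose i) * of_nat ((card V - s) choose (s - i)) * g i)"
  proof (rule sum.cong[OF refl])
    fix i assume i: "i \<in> {..<s}"
    have "{T \<in> ?F - {S}. card (S \<inter> T) = i} = {T. T \<subseteq> V \<and> card T = s \<and> card (S \<inter> T) = i}"
      using i S by auto
    then have "card {T \<in> ?F - {S}. card (S \<inter> T) = i} = (s choose i) * ((card V - s) choose (s - i))"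
      using card_subsets_meeting[OF V S(1), of i s] i S(2) by simp
    then show "(\<Sum>T\<in>{T \<in> ?F - {S}. card (S \<inter> T) = i}. g (card (S \<inter> T)))
        = of_nat (s choose i) * of_nat ((card V - s) choose (s - i)) * g i"
      by simp
  qed
  finally show ?thesis .
qed

section \<open>Quadratic forms\<close>

text \<open>Both the replication matrix of a covering and the inclusion matrices are weighted Gram matrices:
  the index \<open>i\<close> runs over blocks in the first case and over \<open>j\<close>-subsets in the second.\<close>

lemma weighted_gram_form:
  fixes x :: "'a \<Rightarrow> 'f::comm_ring_1"
  shows "(\<Sum>S\<in>X. \<Sum>T\<in>X. x S * x T * (\<Sum>i\<in>I. c i * h i S * h i T))
           = (\<Sum>i\<in>I. c i * (\<Sum>S\<in>X. h i S * x S)\<^sup>2)"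
proof -
  have "(\<Sum>S\<in>X. \<Sum>T\<in>X. x S * x T * (\<Sum>i\<in>I. c i * h i S * h i T))
      = (\<Sum>S\<in>X. \<Sum>i\<in>I. \<Sum>T\<in>X. x S * x T * (c i * h i S * h i T))"
    unfolding sum_distrib_left by (subst (2) sum.swap) (rule refl)
  also have "\<dots> = (\<Sum>i\<in>I. \<Sum>S\<in>X. \<Sum>T\<in>X. x S * x T * (c i * h i S * h i T))"
    by (rule sum.swap)
  also have "\<dots> = (\<Sum>i\<in>I. c i * (\<Sum>S\<in>X. h i S * x S)\<^sup>2)"
    unfolding power2_eq_square sum_product by (simp add: sum_distrib_left mult_ac)
  finally show ?thesis .
qed

text \<open>This is the estimate behind Gershgorin's theorem: each off-diagonal term is bounded
  by \<open>x y \<ge> - (x\<^sup>2 + y\<^sup>2) / 2\<close>, and by symmetry the squares can be collected along rows.\<close>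

lemma quadratic_form_ge_row_sum:
  fixes e :: "'a \<Rightarrow> 'a \<Rightarrow> real"
  assumes nonneg: "\<And>S T. S \<in> X \<Longrightarrow> T \<in> X \<Longrightarrow> 0 \<le> e S T" and sym: "\<And>S T. e S T = e T S"
    and fin: "finite X" and row: "\<And>S. S \<in> X \<Longrightarrow> (\<Sum>T\<in>X - {S}. e S T) \<le> c"
  shows "- c * (\<Sum>S\<in>X. (x S)\<^sup>2) \<le> (\<Sum>S\<in>X. \<Sum>T\<in>X. x S * x T * e S T)"
proof -
  define u where "u S T = (if S = T then 0 else e S T)" for S T
  have u_sym: "u S T = u T S" for S T
    using sym[of S T] by (simp add: u_def)
  have row': "(\<Sum>T\<in>X. u S T) \<le> c" if "S \<in> X" for S
  proof -
    have "(\<Sum>T\<in>X. u S T) = (\<Sum>T\<in>X - {S}. u S T)"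
      using fin by (intro sum.mono_neutral_right) (auto simp: u_def)
    also have "\<dots> = (\<Sum>T\<in>X - {S}. e S T)"
      by (rule sum.cong) (auto simp: u_def)
    finally show ?thesis using row[OF that] by simp
  qed
  have "(\<Sum>S\<in>X. \<Sum>T\<in>X. (x S)\<^sup>2 * u S T) = (\<Sum>S\<in>X. (x S)\<^sup>2 * (\<Sum>T\<in>X. u S T))"
    by (simp add: sum_distrib_left)
  also have "\<dots> \<le> (\<Sum>S\<in>X. (x S)\<^sup>2 * c)"
    using row' by (intro sum_mono mult_left_mono) auto
  finally have A: "(\<Sum>S\<in>X. \<Sum>T\<in>X. (x S)\<^sup>2 * u S T) \<le> c * (\<Sum>S\<in>X. (x S)\<^sup>2)"
    by (simp add: sum_distrib_left mult.commute)
  have B: "(\<Sum>S\<in>X. \<Sum>T\<in>X. (x T)\<^sup>2 * u S T) = (\<Sum>S\<in>X. \<Sum>T\<in>X. (x S)\<^sup>2 * u S T)"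
    by (subst sum.swap) (intro sum.cong refl arg_cong2[of _ _ _ _ "(*)"] u_sym)
  have "- (\<Sum>S\<in>X. \<Sum>T\<in>X. (x S)\<^sup>2 * u S T)
      = (\<Sum>S\<in>X. \<Sum>T\<in>X. - (((x S)\<^sup>2 * u S T + (x T)\<^sup>2 * u S T) / 2))"
    using B by (simp add: sum_negf sum_divide_distrib[symmetric] sum.distrib)
  also have "\<dots> \<le> (\<Sum>S\<in>X. \<Sum>T\<in>X. x S * x T * e S T)"
  proof (intro sum_mono)
    fix S T assume ST: "S \<in> X" "T \<in> X"
    show "- (((x S)\<^sup>2 * u S T + (x T)\<^sup>2 * u S T) / 2) \<le> x S * x T * e S T"
    proof (cases "S = T")
      case True
      then show ?thesis using nonneg[OF ST] by (simp add: u_def)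
    next
      case False
      have "0 \<le> (x S + x T)\<^sup>2 * e S T" using nonneg[OF ST] by simp
      moreover have "x S * x T * e S T + ((x S)\<^sup>2 * e S T + (x T)\<^sup>2 * e S T) / 2
          = (x S + x T)\<^sup>2 * e S T / 2"
        by (simp add: power2_eq_square field_simps)
      ultimately have "- (((x S)\<^sup>2 * e S T + (x T)\<^sup>2 * e S T) / 2) \<le> x S * x T * e S T"
        by linarith
      then show ?thesis using False by (simp add: u_def)
    qed
  qed
  finally show ?thesis using A by simp
qed

section \<open>Blocks through a set of points\<close>

definition replication :: "'a set multiset \<Rightarrow> 'a set \<Rightarrow> nat" where
  "replication \<B> U = size {#B \<in># \<B>. U \<subseteq> B#}"

text \<open>Summing over the distinct blocks with their multiplicities as coefficients allows the sum to be
  interchanged with sums over sets of points.\<close>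

lemma replication_eq_sum:
  "replication \<B> U = (\<Sum>B\<in>set_mset \<B>. count \<B> B * of_bool (U \<subseteq> B))"
proof -
  have "replication \<B> U = (\<Sum>B\<in>{B \<in> set_mset \<B>. U \<subseteq> B}. count \<B> B)"
    unfolding replication_def size_multiset_overloaded_eq
    by (rule sum.cong) auto
  also have "\<dots> = (\<Sum>B\<in>set_mset \<B>. count \<B> B * of_bool (U \<subseteq> B))"
    by (simp add: sum.inter_filter of_bool_def if_distrib cong: if_cong)
  finally show ?thesis .
qed

text \<open>The blocks through \<open>U\<close>, with \<open>U\<close> removed, cover the remaining points with strength
  \<open>t - |U|\<close>. When \<open>|U| = t\<close>, the convention for strength \<open>0\<close> makes the claim the covering
  condition itself.\<close>

lemma covering_number_le_replication:
  assumes cov: "covering t v k lam V \<B>" and U: "U \<subseteq> V" and u: "card U \<le> t"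
  shows "covering_number lam (v - card U) (k - card U) (t - card U) \<le> replication \<B> U"
proof -
  have fin: "finite V" and sub: "\<And>B. B \<in># \<B> \<Longrightarrow> B \<subseteq> V" and cV: "card V = v"
    and ck: "\<And>B. B \<in># \<B> \<Longrightarrow> card B = k"
    and ct: "\<And>T. T \<subseteq> V \<Longrightarrow> card T = t \<Longrightarrow> lam \<le> size {#B \<in># \<B>. T \<subseteq> B#}"
    using cov by (auto simp: covering_def incidence_structure_def)
  have finU: "finite U" using U fin by (rule finite_subset)
  show ?thesis
  proof (cases "card U = t")
    case True
    then show ?thesis using ct[OF U] by (simp add: covering_number_def replication_def)
  next
    case False
    define \<C> where "\<C> = image_mset (\<lambda>B. B - U) {#B \<in># \<B>. U \<subseteq> B#}"
    have "covering (t - card U) (v - card U) (k - card U) lam (V - U) \<C>"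
      unfolding covering_def incidence_structure_def
    proof (intro conjI ballI allI impI)
      show "finite (V - U)" using fin by simp
      show "card (V - U) = v - card U" using U finU cV by (simp add: card_Diff_subset)
      show "C \<subseteq> V - U" if "C \<in># \<C>" for C using that sub by (auto simp: \<C>_def)
      show "card C = k - card U" if "C \<in># \<C>" for C
        using that ck finU by (auto simp: \<C>_def card_Diff_subset)
      show "lam \<le> size {#C \<in># \<C>. T \<subseteq> C#}" if T: "T \<subseteq> V - U \<and> card T = t - card U" for T
      proof -
        have "finite T" "T \<inter> U = {}" using T fin finite_subset by blast+
        then have "card (T \<union> U) = t" using T u finU by (simp add: card_Un_disjoint)
        then have "lam \<le> size {#B \<in># \<B>. T \<union> U \<subseteq> B#}" using T U by (intro ct) auto
        also have "{#B \<in># \<B>. T \<union> U \<subseteq> B#} = {#B \<in># \<B>. T \<subseteq> B - U \<and> U \<subseteq> B#}"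
          using \<open>T \<inter> U = {}\<close> by (intro filter_mset_cong refl) blast
        also have "size \<dots> = size {#C \<in># \<C>. T \<subseteq> C#}"
          by (simp add: \<C>_def filter_mset_image_mset filter_filter_mset conj_commute)
        finally show ?thesis .
      qed
    qed
    from covering_number_le[OF this] False u show ?thesis
      by (simp add: \<C>_def replication_def)
  qed
qed

section \<open>Independent rows of the incidence matrix\<close>

text \<open>If there were more sets in \<open>X\<close> than blocks, some nonzero \<open>x\<close> would be annihilated by every block,
  so the quadratic form of the replication matrix would vanish at \<open>x\<close>. However, its part with the
  coefficients \<open>a j\<close> is at least \<open>a s\<close> times the squared norm of \<open>x\<close>, because each \<open>j\<close> contributes
  a nonnegative term and \<open>j = s\<close> contributes precisely this one, while the part from \<open>e\<close> is at
  least \<open>- c\<close> times the squared norm.\<close>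

lemma card_le_size_if_small_excess:
  fixes a :: "nat \<Rightarrow> real" and e :: "'a set \<Rightarrow> 'a set \<Rightarrow> real"
  assumes V: "finite V" and X: "X \<subseteq> {S. S \<subseteq> V \<and> card S = s}"
    and a: "\<And>j. j \<le> s \<Longrightarrow> 0 \<le> a j"
    and e: "\<And>S T. S \<in> X \<Longrightarrow> T \<in> X \<Longrightarrow> 0 \<le> e S T" "\<And>S T. e S T = e T S"
    and rep: "\<And>S T. S \<in> X \<Longrightarrow> T \<in> X \<Longrightarrow>
      real (replication \<B> (S \<union> T)) = (\<Sum>j\<le>s. a j * real (card (S \<inter> T) choose j)) + e S T"
    and row: "\<And>S. S \<in> X \<Longrightarrow> (\<Sum>T\<in>X - {S}. e S T) \<le> c" and c: "c < a s"
  shows "card X \<le> size \<B>"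
proof (rule ccontr)
  assume "\<not> card X \<le> size \<B>"
  moreover have "card (set_mset \<B>) \<le> size \<B>"
    by (induction \<B>) (auto intro: card_insert_le_m1 simp: card_insert_if)
  ultimately have less: "card (set_mset \<B>) < card X" by simp
  have finX: "finite X" using less by (metis card.infinite not_less_zero)
  obtain x :: "'a set \<Rightarrow> real" where x: "\<exists>S\<in>X. x S \<noteq> 0"
    "\<forall>B\<in>set_mset \<B>. (\<Sum>S\<in>X. of_bool (S \<subseteq> B) * x S) = 0"
    using exists_nontrivial_solution[OF finite_set_mset finX less, of "\<lambda>B S. of_bool (S \<subseteq> B)"]
    by blast
  define N where "N = (\<Sum>S\<in>X. (x S)\<^sup>2)"
  have N: "0 < N"
    using x(1) finX unfolding N_def by (metis sum_pos2 zero_le_power2 zero_less_power2)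
  have subsets_form: "(\<Sum>S\<in>X. \<Sum>T\<in>X. x S * x T * real (card (S \<inter> T) choose j))
      = (\<Sum>J | J \<subseteq> V \<and> card J = j. (\<Sum>S\<in>X. of_bool (J \<subseteq> S) * x S)\<^sup>2)" for j
  proof -
    have "real (card (S \<inter> T) choose j)
        = (\<Sum>J | J \<subseteq> V \<and> card J = j. 1 * of_bool (J \<subseteq> S) * of_bool (J \<subseteq> T))"
      if "S \<in> X" for S T
    proof -
      have ST: "S \<inter> T \<subseteq> V" "finite (S \<inter> T)" using that X V by (auto intro: finite_subset)
      have "real (card (S \<inter> T) choose j) = (\<Sum>J | J \<subseteq> S \<inter> T \<and> card J = j. 1)"
        using n_subsets[OF ST(2), of j] by simp
      also have "\<dots> = (\<Sum>J | J \<subseteq> V \<and> card J = j. 1 * of_bool (J \<subseteq> S) * of_bool (J \<subseteq> T))"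
        using V ST by (intro sum.mono_neutral_cong_left) auto
      finally show ?thesis .
    qed
    then have "(\<Sum>S\<in>X. \<Sum>T\<in>X. x S * x T * real (card (S \<inter> T) choose j))
      = (\<Sum>S\<in>X. \<Sum>T\<in>X. x S * x T *
          (\<Sum>J | J \<subseteq> V \<and> card J = j. 1 * of_bool (J \<subseteq> S) * of_bool (J \<subseteq> T)))"
      by (intro sum.cong refl) simp
    then show ?thesis unfolding weighted_gram_form by simp
  qed
  have "(\<Sum>S\<in>X. \<Sum>T\<in>X. x S * x T * real (card (S \<inter> T) choose s)) = N"
  proof -
    have "real (card (S \<inter> T) choose s) = of_bool (S = T)" if "S \<in> X" "T \<in> X" for S T
    proof (cases "S = T")
      case True
      then show ?thesis using that X by auto
    next
      case False
      have "finite S" "finite T" "card S = s" "card T = s"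
        using that X V by (auto intro: finite_subset)
      then show ?thesis using False card_Int_less[of S T] by simp
    qed
    then have "(\<Sum>S\<in>X. \<Sum>T\<in>X. x S * x T * real (card (S \<inter> T) choose s))
        = (\<Sum>S\<in>X. \<Sum>T\<in>X. if S = T then x S * x T else 0)"
      by (intro sum.cong refl) auto
    also have "\<dots> = N" using finX by (simp add: N_def power2_eq_square)
    finally show ?thesis .
  qed
  then have "a s * N = a s * (\<Sum>S\<in>X. \<Sum>T\<in>X. x S * x T * real (card (S \<inter> T) choose s))"
    by simp
  also have "\<dots> \<le> (\<Sum>j\<le>s. a j * (\<Sum>S\<in>X. \<Sum>T\<in>X. x S * x T * real (card (S \<inter> T) choose j)))"
    using a by (intro member_le_sum) (auto simp: subsets_form intro!: mult_nonneg_nonneg sum_nonneg)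
  also have "\<dots> = (\<Sum>S\<in>X. \<Sum>T\<in>X. x S * x T * (\<Sum>j\<le>s. a j * real (card (S \<inter> T) choose j)))"
  proof -
    have "(\<Sum>j\<le>s. a j * (\<Sum>S\<in>X. \<Sum>T\<in>X. x S * x T * real (card (S \<inter> T) choose j)))
        = (\<Sum>S\<in>X. \<Sum>j\<le>s. \<Sum>T\<in>X. a j * (x S * x T * real (card (S \<inter> T) choose j)))"
      unfolding sum_distrib_left by (rule sum.swap)
    also have "\<dots> = (\<Sum>S\<in>X. \<Sum>T\<in>X. \<Sum>j\<le>s. a j * (x S * x T * real (card (S \<inter> T) choose j)))"
      by (intro sum.cong refl sum.swap)
    finally show ?thesis by (simp add: sum_distrib_left mult_ac)
  qed
  finally have P: "a s * N
      \<le> (\<Sum>S\<in>X. \<Sum>T\<in>X. x S * x T * (\<Sum>j\<le>s. a j * real (card (S \<inter> T) choose j)))" .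
  have E: "- c * N \<le> (\<Sum>S\<in>X. \<Sum>T\<in>X. x S * x T * e S T)"
    unfolding N_def using e finX row by (rule quadratic_form_ge_row_sum)
  have "(\<Sum>S\<in>X. \<Sum>T\<in>X. x S * x T * real (replication \<B> (S \<union> T)))
      = (\<Sum>S\<in>X. \<Sum>T\<in>X. x S * x T *
          (\<Sum>B\<in>set_mset \<B>. real (count \<B> B) * of_bool (S \<subseteq> B) * of_bool (T \<subseteq> B)))"
    by (simp add: replication_eq_sum of_bool_conj mult.assoc)
  also have "\<dots> = 0" unfolding weighted_gram_form using x(2) by simp
  finally have "(\<Sum>S\<in>X. \<Sum>T\<in>X. x S * x T * real (replication \<B> (S \<union> T))) = 0" .
  moreover have "(\<Sum>S\<in>X. \<Sum>T\<in>X. x S * x T * real (replication \<B> (S \<union> T)))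
      = (\<Sum>S\<in>X. \<Sum>T\<in>X. x S * x T * (\<Sum>j\<le>s. a j * real (card (S \<inter> T) choose j)))
        + (\<Sum>S\<in>X. \<Sum>T\<in>X. x S * x T * e S T)"
    by (simp add: rep distrib_left sum.distrib)
  ultimately have "a s * N \<le> c * N" using P E by simp
  then show False using c N by simp
qed

section \<open>Degrees in the excess multigraph\<close>

text \<open>Double counting of pairs of a block through \<open>S\<close> and an \<open>s\<close>-subset of it. The case \<open>S = {}\<close>
  counts the incidences between \<open>s\<close>-subsets and blocks.\<close>

lemma sum_replication_union:
  assumes V: "finite V" and sub: "\<And>B. B \<in># \<B> \<Longrightarrow> B \<subseteq> V \<and> card B = k"
  shows "(\<Sum>T | T \<subseteq> V \<and> card T = s. replication \<B> (S \<union> T)) = replication \<B> S * (k choose s)"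
proof -
  let ?F = "{T. T \<subseteq> V \<and> card T = s}"
  have "(\<Sum>T\<in>?F. replication \<B> (S \<union> T))
      = (\<Sum>B\<in>set_mset \<B>. count \<B> B * of_bool (S \<subseteq> B) * (\<Sum>T\<in>?F. of_bool (T \<subseteq> B)))"
    unfolding replication_eq_sum sum_distrib_left
    by (subst sum.swap) (simp add: of_bool_conj mult.assoc)
  also have "\<dots> = (\<Sum>B\<in>set_mset \<B>. count \<B> B * of_bool (S \<subseteq> B) * (k choose s))"
  proof (intro sum.cong refl arg_cong2[of _ _ _ _ "(*)"])
    fix B assume "B \<in># \<B>"
    with sub have B: "B \<subseteq> V" "card B = k" by auto
    have "(\<Sum>T\<in>?F. of_bool (T \<subseteq> B)) = card {T. T \<subseteq> B \<and> card T = s}"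
      using V B(1) by (auto simp: sum_of_bool_eq intro!: arg_cong[where f = card])
    then show "(\<Sum>T\<in>?F. of_bool (T \<subseteq> B)) = k choose s"
      using B V finite_subset by (metis n_subsets)
  qed
  finally show ?thesis by (simp only: replication_eq_sum sum_distrib_right)
qed

text \<open>A convex function lies above the secant through its values at \<open>r = 0\<close> and \<open>r = 1\<close>, except
  strictly between these points, where no natural number lies.\<close>

lemma inverse_le_secant:
  fixes D A c :: real
  assumes "0 < D" "0 \<le> A" "0 \<le> c"
  shows "c / D - (c / D - c / (D + A)) * real r \<le> c / (D + real r * A)"
proof (cases "r = 0")
  case False
  have "c / D - c / (D + real r * A) = real r * (c * A / (D * (D + real r * A)))"
    using assms by (simp add: diff_frac_eq add_pos_nonneg less_imp_neq[symmetric] algebra_simps)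
  also have "\<dots> \<le> real r * (c * A / (D * (D + A)))"
    using assms False
    by (intro mult_left_mono divide_left_mono add_mono) (auto intro: mult_le_cancel_right1[THEN iffD2] simp: add_pos_nonneg)
  also have "c * A / (D * (D + A)) = c / D - c / (D + A)"
    using assms by (simp add: diff_frac_eq add_pos_nonneg less_imp_neq[symmetric] algebra_simps)
  finally show ?thesis by (simp add: mult.commute)
qed simp

section \<open>The lower bound for the covering number\<close>

theorem theorem15:
  fixes t v k lam s :: nat and a b :: "nat \<Rightarrow> int" and d :: int
  assumes "0 < t" and "0 < v" and "0 < k" and "0 < lam" and "0 < s"
    and "t < k" and "k < v" and "s \<le> t div 2"
    and "\<And>i. i \<in> {s..2 * s} \<Longrightarrow> 0 < b i"
    and "schonheim_bound lam (v - 2 * s) (k - 2 * s) (t - 2 * s) \<le> b (2 * s)"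
    and "b (2 * s) \<le> int (covering_number lam (v - 2 * s) (k - 2 * s) (t - 2 * s))"
    and "\<And>i. i \<in> {s..2 * s - 1} \<Longrightarrow>
           \<lceil>real (v - i) / real (k - i) * real_of_int (b (i + 1))\<rceil> \<le> b i \<and>
           b i \<le> int (covering_number lam (v - i) (k - i) (t - i))"
    and "\<And>j. j \<in> {0..s} \<Longrightarrow>
           a j = (\<Sum>i = 0..j. (-1) ^ (i + j) * int (j choose i) * b (2 * s - i))"
    and "\<And>j. j \<in> {0..s} \<Longrightarrow> 0 \<le> a j"
    and "d = b s * (int (k choose s) - 1)
           - (\<Sum>i = 0..s - 1. int (s choose i) * int ((v - s) choose (s - i)) * b (2 * s - i))"
    and "b s < int (k choose s)"
    and "a s \<le> d" and "1 \<le> a s"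
  shows "\<lceil>CB v k s (b s)
            (real_of_int (a s + 1) / real_of_int (2 * (d + 1)))
            (real_of_int (a s + 1) / real_of_int (2 * (d + int (k choose s))))\<rceil>
         \<le> int (covering_number lam v k t)"
proof -
  define K where "K = k choose s"
  define m where "m = nat (a s)"
  have st: "2 * s \<le> t" using assms(8) by simp
  obtain V :: "nat set" and \<B> where cov: "covering t v k lam V \<B>"
    and size: "size \<B> = covering_number lam v k t"
    using covering_number_attained[of t k v lam] assms(1,6,7) by auto
  have V: "finite V" "card V = v" and blocks: "\<And>B. B \<in># \<B> \<Longrightarrow> B \<subseteq> V \<and> card B = k"
    using cov by (auto simp: covering_def incidence_structure_def)
  define F where "F = {S. S \<subseteq> V \<and> card S = s}"
  have finF: "finite F" using V by (simp add: F_def)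
  have cardF: "card F = v choose s" using V by (simp add: F_def n_subsets)
  have fin: "finite S" if "S \<in> F" for S using that V by (auto simp: F_def intro: finite_subset)
  have card_int: "card (S \<inter> T) \<le> s" if "S \<in> F" "T \<in> F" for S T
    using card_mono[OF fin[OF that(1)], of "S \<inter> T"] that by (simp add: F_def)
  have card_un: "card (S \<union> T) = 2 * s - card (S \<inter> T)" if "S \<in> F" "T \<in> F" for S T
    using card_Un_Int[OF fin[OF that(1)] fin[OF that(2)]] that by (simp add: F_def)
  have b_le: "b (card U) \<le> int (replication \<B> U)"
    if U: "U \<subseteq> V" "s \<le> card U" "card U \<le> 2 * s" for U
  proof -
    have "b (card U) \<le> int (covering_number lam (v - card U) (k - card U) (t - card U))"
    proof (cases "card U = 2 * s")
      case True
      then show ?thesis using assms(11) by simp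
    next
      case False
      then have "card U \<in> {s..2 * s - 1}" using U by simp
      then show ?thesis using assms(12) by blast
    qed
    moreover have "covering_number lam (v - card U) (k - card U) (t - card U) \<le> replication \<B> U"
      using covering_number_le_replication[OF cov U(1)] U(3) st by simp
    ultimately show ?thesis by linarith
  qed
  \<comment> \<open>The differences are nonnegative by \<open>b_le\<close>, so truncation to natural numbers loses nothing;
    natural edge multiplicities are what the bound for multigraphs requires.\<close>
  define w where "w S T = nat (int (replication \<B> (S \<union> T)) - b (card (S \<union> T)))" for S T
  have w_sym: "w S T = w T S" for S T by (simp add: w_def Un_commute)
  have w: "int (w S T) = int (replication \<B> (S \<union> T)) - b (2 * s - card (S \<inter> T))"
    if "S \<in> F" "T \<in> F" for S T
    using b_le[of "S \<union> T"] card_un[OF that] card_int[OF that] that by (simp add: w_def F_def)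
  define excess where "excess S = nat (int (replication \<B> S) - b s)" for S
  have excess: "int (excess S) = int (replication \<B> S) - b s" if "S \<in> F" for S
    using b_le[of S] that by (simp add: excess_def F_def)
  \<comment> \<open>An \<open>s\<close>-subset with exactly \<open>b s\<close> blocks has degree \<open>d\<close>; each further block through it adds
    \<open>K - 1\<close>, one for every other \<open>s\<close>-subset of that block.\<close>
  have row_sum: "int (\<Sum>T\<in>F - {S}. w S T) = d + int (excess S) * (int K - 1)" if S: "S \<in> F" for S
  proof -
    have "(\<Sum>T\<in>F. replication \<B> (S \<union> T)) = replication \<B> S * K"
      unfolding F_def K_def using V(1) blocks by (rule sum_replication_union)
    then have "replication \<B> S + (\<Sum>T\<in>F - {S}. replication \<B> (S \<union> T)) = replication \<B> S * K"
      using S finF by (simp add: sum.remove)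
    then have rep: "int (\<Sum>T\<in>F - {S}. replication \<B> (S \<union> T))
        = int (replication \<B> S) * int K - int (replication \<B> S)"
      by (metis add_diff_cancel_left' of_nat_add of_nat_mult)
    have R: "int (replication \<B> S) = b s + int (excess S)" using excess[OF S] by simp
    have "(\<Sum>T\<in>F - {S}. b (2 * s - card (S \<inter> T)))
        = (\<Sum>i<s. int (s choose i) * int ((v - s) choose (s - i)) * b (2 * s - i))"
      using sum_by_intersection_size[OF V(1), of S s "\<lambda>i. b (2 * s - i)"] S V(2)
      by (simp add: F_def)
    also have "{..<s} = {0..s - 1}" using assms(5) by auto
    finally have "(\<Sum>T\<in>F - {S}. b (2 * s - card (S \<inter> T))) = b s * (int K - 1) - d"
      using assms(15) by (simp add: K_def)
    moreover have "int (\<Sum>T\<in>F - {S}. w S T) = int (\<Sum>T\<in>F - {S}. replication \<B> (S \<union> T))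
        - (\<Sum>T\<in>F - {S}. b (2 * s - card (S \<inter> T)))"
      using S w by (simp add: sum_subtractf)
    ultimately show ?thesis using rep R by (simp add: algebra_simps)
  qed
  have m: "0 < m" "int m = a s" using assms(18) by (auto simp: m_def)
  obtain X where X: "X \<subseteq> F" "\<forall>S\<in>X. (\<Sum>T\<in>X - {S}. w S T) < m"
    "(\<Sum>S\<in>F. caro_tuza_weight m (\<Sum>T\<in>F - {S}. w S T)) \<le> real (card X)"
    using caro_tuza_bound[where w = w, OF finF w_sym m(1)] by blast
  have "card X \<le> size \<B>"
  proof (rule card_le_size_if_small_excess[where s = s and V = V and c = "real m - 1"
        and a = "\<lambda>j. real_of_int (a j)" and e = "\<lambda>S T. real (w S T)"])
    show "X \<subseteq> {S. S \<subseteq> V \<and> card S = s}" using X(1) by (simp add: F_def)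
    show "0 \<le> real_of_int (a j)" if "j \<le> s" for j using assms(14) that by simp
    show "real (w S T) = real (w T S)" for S T by (simp add: w_sym)
    show "real m - 1 < real_of_int (a s)" using m(2) by linarith
    show "(\<Sum>T\<in>X - {S}. real (w S T)) \<le> real m - 1" if "S \<in> X" for S
    proof -
      have "(\<Sum>T\<in>X - {S}. w S T) + 1 \<le> m" using X(2) that by (simp add: Suc_leI)
      then have "real ((\<Sum>T\<in>X - {S}. w S T) + 1) \<le> real m" by (simp only: of_nat_le_iff)
      then show ?thesis by simp
    qed
    show "real (replication \<B> (S \<union> T))
        = (\<Sum>j\<le>s. real_of_int (a j) * real (card (S \<inter> T) choose j)) + real (w S T)"
      if "S \<in> X" "T \<in> X" for S T
    proof -
      have ST: "S \<in> F" "T \<in> F" using that X(1) by auto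
      define n where "n = card (S \<inter> T)"
      have n: "n \<le> s" using card_int[OF ST] by (simp add: n_def)
      have "b (2 * s - n)
          = (\<Sum>j\<le>n. int (n choose j) * (\<Sum>i\<le>j. (-1) ^ (i + j) * int (j choose i) * b (2 * s - i)))"
        using binomial_inversion[of n "\<lambda>i. b (2 * s - i)"] by simp
      also have "\<dots> = (\<Sum>j\<le>n. int (n choose j) * a j)"
        using n assms(13) by (intro sum.cong refl) (simp add: atLeast0AtMost)
      also have "\<dots> = (\<Sum>j\<le>s. a j * int (n choose j))"
        using n by (intro sum.mono_neutral_cong_left) auto
      finally have "int (replication \<B> (S \<union> T)) = (\<Sum>j\<le>s. a j * int (n choose j)) + int (w S T)"
        using w[OF ST] by (simp add: n_def)
      then have "real_of_int (int (replication \<B> (S \<union> T)))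
          = real_of_int ((\<Sum>j\<le>s. a j * int (n choose j)) + int (w S T))" by (rule arg_cong)
      then show ?thesis by (simp add: n_def)
    qed
  qed (use V in auto)
  define \<alpha> where "\<alpha> = real_of_int (a s + 1) / real_of_int (2 * (d + 1))"
  define \<beta> where "\<beta> = real_of_int (a s + 1) / real_of_int (2 * (d + int K))"
  have d: "1 \<le> d" using assms(17,18) by simp
  have K: "1 \<le> K" using assms(6) st by (simp add: K_def Suc_le_eq)
  have "\<beta> \<le> \<alpha>"
    unfolding \<alpha>_def \<beta>_def using d K assms(18) by (intro divide_left_mono mult_pos_pos) auto
  have weight: "\<alpha> - (\<alpha> - \<beta>) * real (excess S) \<le> caro_tuza_weight m (\<Sum>T\<in>F - {S}. w S T)"
    if S: "S \<in> F" for S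
  proof -
    define D where "D = (\<Sum>T\<in>F - {S}. w S T)"
    have D: "int D = d + int (excess S) * (int K - 1)" using row_sum[OF S] by (simp add: D_def)
    then have Dr: "real D = real_of_int d + real (excess S) * (real K - 1)"
      by (metis (mono_tags) of_int_1 of_int_add of_int_diff of_int_mult of_int_of_nat_eq)
    have "int m \<le> int D" using D K m(2) assms(17) by (simp add: add_increasing2)
    then have "caro_tuza_weight m D = ((real m + 1) / 2) / (real D + 1)"
      by (simp add: caro_tuza_weight_def)
    moreover have "real m = real_of_int (a s)" using m(2) by (metis of_int_of_nat_eq)
    ultimately have *: "caro_tuza_weight m D
        = ((a s + 1) / 2) / ((real_of_int d + 1) + real (excess S) * (real K - 1))"
      using Dr by (simp add: algebra_simps)
    have "(a s + 1) / 2 / (real_of_int d + 1)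
        - ((a s + 1) / 2 / (real_of_int d + 1)
           - (a s + 1) / 2 / ((real_of_int d + 1) + (real K - 1))) * real (excess S)
      \<le> caro_tuza_weight m D"
      unfolding * using d K assms(18) by (intro inverse_le_secant) auto
    moreover have "(a s + 1) / 2 / (real_of_int d + 1) = \<alpha>"
      "(a s + 1) / 2 / ((real_of_int d + 1) + (real K - 1)) = \<beta>"
      by (simp_all add: \<alpha>_def \<beta>_def)
    ultimately show ?thesis by (simp add: D_def)
  qed
  have sum_excess: "(\<Sum>S\<in>F. real (excess S)) = real (size \<B>) * real K - b s * real (v choose s)"
  proof -
    have "(\<Sum>S\<in>F. replication \<B> S) = size \<B> * K"
      using sum_replication_union[OF V(1) blocks, where S = "{}"]
      by (simp add: F_def K_def replication_def)
    moreover have "(\<Sum>S\<in>F. int (excess S)) = int (\<Sum>S\<in>F. replication \<B> S) - b s * int (v choose s)"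
      by (simp add: excess sum_subtractf cardF)
    ultimately have "(\<Sum>S\<in>F. int (excess S)) = int (size \<B> * K) - b s * int (v choose s)" by simp
    then have "real_of_int (\<Sum>S\<in>F. int (excess S))
        = real_of_int (int (size \<B> * K) - b s * int (v choose s))" by (rule arg_cong)
    then show ?thesis by simp
  qed
  have "\<alpha> * real (v choose s) - (\<alpha> - \<beta>) * (real (size \<B>) * real K - b s * real (v choose s))
      = (\<Sum>S\<in>F. \<alpha> - (\<alpha> - \<beta>) * real (excess S))"
    by (simp add: sum_subtractf sum_distrib_left[symmetric] sum_excess cardF)
  also have "\<dots> \<le> (\<Sum>S\<in>F. caro_tuza_weight m (\<Sum>T\<in>F - {S}. w S T))"
    by (rule sum_mono) (rule weight)
  also have "\<dots> \<le> real (size \<B>)" using X(3) \<open>card X \<le> size \<B>\<close> by linarith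
  finally have "b s * (\<alpha> - \<beta>) * real (v choose s) + \<alpha> * real (v choose s)
      \<le> real (size \<B>) * ((\<alpha> - \<beta>) * real K + 1)"
    by (simp add: algebra_simps)
  moreover have "0 < (\<alpha> - \<beta>) * real K + 1"
    using \<open>\<beta> \<le> \<alpha>\<close> by (simp add: add_nonneg_pos)
  ultimately have "CB v k s (b s) \<alpha> \<beta> \<le> real (covering_number lam v k t)"
    by (simp add: CB_def K_def[symmetric] pos_divide_le_eq size)
  then show ?thesis
    unfolding \<alpha>_def \<beta>_def K_def by (simp add: ceiling_le_iff)
qed
end
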